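(* For all integers $j,k\ge0$, $$A_{j,k,1}=2k\,D_{2j,k}+8(j-k+1)\,D_{2j,k-1}.$$
   Context: For $n\ge1$, $\mathfrak B_n$ is the hyperoctahedral group of signed permutations: words $\pi=\pi_1\cdots\pi_n$ of nonzero integers such that $|\pi_1|,\dots,|\pi_n|$ is a permutation of $[n]=\{1,\dots,n\}$, with $\pi(i)=\pi_i$, $\pi(-i)=-\pi(i)$. $\mathcal I_n^B$ is the set of $\pi\in\mathfrak B_n$ with $\pi^2=\mathrm{id}$ (for $n=0$, a single empty involution). With $\pi_0=0$ and the usual order on $\mathbb Z$, $\operatorname{des}^B(\pi)=\#\{0\le i\le n-1:\pi_i>\pi_{i+1}\}$, and $\operatorname{fix}_B(\pi)=\#\{i\in[n]:|\pi(i)|=i\}$. Let $J_{2j}^B(t)=\sum t^{\operatorname{des}^B(\pi)}$ over $\pi\in\mathcal I_{2j}^B$ with $\operatorname{fix}_B(\pi)=0$, and let $P_j(x)=\sum_{s=0}^jD_{2j,s}x^s$ be the unique polynomial with $J_{2j}^B(t)=(1+t)^{2j}P_j\!\left(\frac{t}{(1+t)^2}\right)$ (it exists because $J_{2j}^B$ is palindromic with center $j$). Convention: $D_{2j,s}=0$ for $s<0$ or $s>j$. The numbers $A_{j,k,r}$ are the coefficients in $A_{j,r}(x)=\sum_kA_{j,k,r}x^k$, where $$\sum_{r\ge0}A_{j,r}(x)W^r=(1+4xW)^{2j}\,P_j\!\left(\frac{x(1+2W+4xW^2)}{(1+4xW)^2}\right).$$ *)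

theory Defs
  imports "HOL-Computational_Algebra.Computational_Algebra"
begin

text \<open>
  A signed permutation of \<open>[n]\<close> is represented by an odd function on the integers, so that the
  conventions \<open>\<pi> 0 = 0\<close> and \<open>\<pi> (- i) = - \<pi> i\<close> are built in. Outside \<open>{- n..n}\<close> the function is
  normalised to the identity, so that words \<open>\<pi> 1, \<dots>, \<pi> n\<close> and functions correspond bijectively.
\<close>

definition signed_perms :: "nat \<Rightarrow> (int \<Rightarrow> int) set" where
  "signed_perms n =
     {\<pi>. (\<forall>i. \<pi> (- i) = - \<pi> i) \<and>
         bij_betw (\<lambda>i. \<bar>\<pi> i\<bar>) {1..int n} {1..int n} \<and>
         (\<forall>i. \<bar>i\<bar> > int n \<longrightarrow> \<pi> i = i)}"

definition involutions_B :: "nat \<Rightarrow> (int \<Rightarrow> int) set" where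
  "involutions_B n = {\<pi> \<in> signed_perms n. \<pi> \<circ> \<pi> = id}"

definition des_B :: "nat \<Rightarrow> (int \<Rightarrow> int) \<Rightarrow> nat" where
  "des_B n \<pi> = card {i. 0 \<le> i \<and> i \<le> int n - 1 \<and> \<pi> i > \<pi> (i + 1)}"

definition fix_B :: "nat \<Rightarrow> (int \<Rightarrow> int) \<Rightarrow> nat" where
  "fix_B n \<pi> = card {i \<in> {1..int n}. \<bar>\<pi> i\<bar> = i}"

definition J_B :: "nat \<Rightarrow> real poly" where
  "J_B n = (\<Sum>\<pi> | \<pi> \<in> involutions_B n \<and> fix_B n \<pi> = 0. monom 1 (des_B n \<pi>))"

text \<open>
  The identity of rational functions \<open>J(t) = (1 + t)^(2j) P(t / (1 + t)^2)\<close> is stated pointwise at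
  all real \<open>t\<close> other than the pole \<open>-1\<close>.
\<close>

definition P_B :: "nat \<Rightarrow> real poly" where
  "P_B j = (THE P. degree P \<le> j \<and>
     (\<forall>t. t \<noteq> -1 \<longrightarrow> poly (J_B (2 * j)) t = (1 + t) ^ (2 * j) * poly P (t / (1 + t) ^ 2)))"

text \<open>\<open>D_B j s\<close> stands for \<open>D\<^bsub>2j,s\<^esub>\<close>; it vanishes outside \<open>0 \<le> s \<le> j\<close>.\<close>

definition D_B :: "nat \<Rightarrow> int \<Rightarrow> real" where
  "D_B j s = (if 0 \<le> s \<and> s \<le> int j then coeff (P_B j) (nat s) else 0)"

text \<open>
  The generating function of the \<open>A\<^bsub>j,r\<^esub>(x)\<close> lives in \<open>\<real>[[x]][[W]]\<close>: the inner series variable is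
  \<open>x\<close>, the outer one is \<open>W\<close>. The denominator has constant term \<open>1\<close> in \<open>W\<close>, hence is a unit.
\<close>

definition gf_x :: "real fps fps" where
  "gf_x = fps_const fps_X"

definition gf_W :: "real fps fps" where
  "gf_W = fps_X"

definition A_gf :: "nat \<Rightarrow> real fps fps" where
  "A_gf j = (1 + 4 * gf_x * gf_W) ^ (2 * j) *
     poly (map_poly (\<lambda>c. fps_const (fps_const c)) (P_B j))
       ((gf_x * (1 + 2 * gf_W + 4 * gf_x * gf_W ^ 2)) / (1 + 4 * gf_x * gf_W) ^ 2)"

text \<open>
  The scalars \<open>\<real>[[x]]\<close> do not form a field, so the library's simplification rules for \<open>/\<close> on power
  series over division rings do not apply; this is the fact that the quotient above is the true one.
\<close>

lemma gf_quotient: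
  "f / (1 + 4 * gf_x * gf_W) ^ 2 * (1 + 4 * gf_x * gf_W) ^ 2 = f"
proof -
  let ?g = "(1 + 4 * gf_x * gf_W) ^ 2 :: real fps fps"
  have g0: "?g $ 0 = 1"
    by (simp add: gf_x_def gf_W_def fps_power_zeroth)
  have "inverse (1 :: real fps) = 1"
    by (rule fps_inverse_one') simp
  hence "?g * inverse ?g = 1"
    unfolding fps_inverse_def using g0 by (intro fps_right_inverse) simp
  moreover have "f / ?g = f * inverse ?g"
    by (rule fps_divide_unit) (simp only: g0, simp)
  ultimately show ?thesis
    by (simp add: mult.assoc mult.commute)
qed

definition A_coeff :: "nat \<Rightarrow> nat \<Rightarrow> nat \<Rightarrow> real" where
  "A_coeff j k r = A_gf j $ r $ k"

end

theory Submission
  imports Defs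
begin

text \<open>
  Negating every letter of a signed permutation replaces \<open>des\<^sup>B\<close> by \<open>2j - des\<^sup>B\<close> and keeps the
  fixed-point-free involutions, so \<open>J\<close> is palindromic. With \<open>u = 1/(1+t)\<close> and \<open>v = t/(1+t)\<close> we have
  \<open>u + v = 1\<close> and \<open>uv = t/(1+t)\<^sup>2\<close>, and \<open>2J(t)/(1+t)\<^sup>2\<^sup>j\<close> is a sum of symmetric expressions
  \<open>u\<^sup>a v\<^sup>b + u\<^sup>b v\<^sup>a\<close> with \<open>a + b = 2j\<close>, each a polynomial of degree at most \<open>j\<close> in \<open>uv\<close>. Hence \<open>P\<^sub>j\<close>
  exists with degree at most \<open>j\<close>, the denominators in the generating function cancel, and the
  coefficient of \<open>W\<close> is read off termwise.
\<close>

section \<open>Symmetric functions of two numbers with sum one\<close>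

text \<open>Newton's recurrence: for \<open>u + v = 1\<close> the power sums satisfy
  \<open>p (n+2) = p (n+1) - u v * p n\<close>. The factor \<open>u v\<close> raises the degree by
  one while \<open>n\<close> grows by two, which gives the bound \<open>n div 2\<close>.\<close>

lemma power_sum_poly:
  "\<exists>Q :: 'a :: comm_ring_1 poly. degree Q \<le> n div 2 \<and>
     (\<forall>u v. u + v = 1 \<longrightarrow> u ^ n + v ^ n = poly Q (u * v))"
proof (induction n rule: less_induct)
  case (less n)
  consider "n = 0" | "n = 1" | m where "n = Suc (Suc m)"
    by (metis One_nat_def not0_implies_Suc)
  then show ?case
  proof cases
    case 1
    then show ?thesis by (intro exI[of _ "[:2:]"]) auto
  next
    case 2
    then show ?thesis by (intro exI[of _ "[:1:]"]) auto
  next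
    case 3
    from less[of m] 3 obtain Q where Q: "degree Q \<le> m div 2"
      "\<And>u v :: 'a. u + v = 1 \<Longrightarrow> u ^ m + v ^ m = poly Q (u * v)" by auto
    from less[of "Suc m"] 3 obtain R where R: "degree R \<le> Suc m div 2"
      "\<And>u v :: 'a. u + v = 1 \<Longrightarrow> u ^ Suc m + v ^ Suc m = poly R (u * v)" by auto
    have "degree (R - pCons 0 Q) \<le> n div 2"
      using Q(1) R(1) 3 by (intro degree_diff_le order.trans[OF degree_pCons_le]) auto
    moreover have "u ^ n + v ^ n = poly (R - pCons 0 Q) (u * v)" if "u + v = 1" for u v :: 'a
    proof -
      have "u ^ n + v ^ n = (u + v) * (u ^ Suc m + v ^ Suc m) - u * v * (u ^ m + v ^ m)"
        by (simp add: 3 algebra_simps)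
      then show ?thesis
        using Q(2)[OF that] R(2)[OF that] that by simp
    qed
    ultimately show ?thesis by blast
  qed
qed

text \<open>For \<open>a \<le> b\<close>, factoring out \<open>(u * v) ^ a\<close> leaves the power
  sum of exponent \<open>b - a\<close>; the claim is symmetric in \<open>a\<close> and
  \<open>b\<close>.\<close>

lemma symmetric_monomial_poly:
  "\<exists>Q :: 'a :: comm_ring_1 poly. degree Q \<le> (a + b) div 2 \<and>
     (\<forall>u v. u + v = 1 \<longrightarrow> u ^ a * v ^ b + u ^ b * v ^ a = poly Q (u * v))"
proof (induction a b rule: linorder_wlog)
  case (le a b)
  obtain Q :: "'a poly" where Q: "degree Q \<le> (b - a) div 2"
    "\<And>u v. u + v = 1 \<Longrightarrow> u ^ (b - a) + v ^ (b - a) = poly Q (u * v)"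
    using power_sum_poly[of "b - a"] by blast
  have "degree (monom 1 a * Q) \<le> a + (b - a) div 2"
    using Q(1) degree_mult_le[of "monom 1 a" Q] degree_monom_le[of "1 :: 'a" a] by linarith
  also have "\<dots> = (a + b) div 2" using le by linarith
  finally have "degree (monom 1 a * Q) \<le> (a + b) div 2" .
  moreover have "u ^ a * v ^ b + u ^ b * v ^ a = poly (monom 1 a * Q) (u * v)"
    if "u + v = 1" for u v
  proof -
    have "w ^ b = w ^ a * w ^ (b - a)" for w :: 'a
      using le by (simp flip: power_add)
    then have "u ^ a * v ^ b + u ^ b * v ^ a = (u * v) ^ a * (u ^ (b - a) + v ^ (b - a))"
      by (simp add: algebra_simps power_mult_distrib)
    then show ?thesis
      using Q(2)[OF that] by (simp add: poly_monom)
  qed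
  ultimately show ?case by blast
next
  case (sym a b)
  then show ?case by (simp add: add.commute)
qed

section \<open>Palindromicity\<close>

text \<open>Negation is confined to the window because elements of \<open>signed_perms n\<close>
  must remain the identity outside it.\<close>

definition neg_word :: "nat \<Rightarrow> (int \<Rightarrow> int) \<Rightarrow> int \<Rightarrow> int" where
  "neg_word n \<pi> i = (if \<bar>i\<bar> \<le> int n then - \<pi> i else \<pi> i)"

lemma neg_word_neg_word [simp]: "neg_word n (neg_word n \<pi>) = \<pi>"
  by (auto simp: neg_word_def)

lemma signed_perms_abs_le:
  assumes "\<pi> \<in> signed_perms n" "\<bar>i\<bar> \<le> int n"
  shows "\<bar>\<pi> i\<bar> \<le> int n"
proof -
  have odd: "\<pi> (- i) = - \<pi> i" for i
    using assms(1) by (simp add: signed_perms_def)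
  have pos: "\<bar>\<pi> i\<bar> \<le> int n" if "1 \<le> i" "i \<le> int n" for i
    using assms(1) that bij_betwE[of "\<lambda>i. \<bar>\<pi> i\<bar>" "{1..int n}" "{1..int n}"]
    by (auto simp: signed_perms_def)
  show ?thesis
    using pos[of i] pos[of "- i"] odd[of i] odd[of 0] assms(2)
    by (cases i "0 :: int" rule: linorder_cases) auto
qed

text \<open>Inside the window \<open>\<pi>\<close> stays inside, so two signs are introduced, and
  they cancel because \<open>\<pi>\<close> is odd.\<close>

lemma neg_word_involutions_B:
  assumes "\<pi> \<in> involutions_B n"
  shows "neg_word n \<pi> \<in> involutions_B n"
proof -
  have \<pi>: "\<pi> \<in> signed_perms n" and inv: "\<pi> (\<pi> i) = i" for i
    using assms by (auto simp: involutions_B_def fun_eq_iff)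
  have odd: "\<pi> (- i) = - \<pi> i" and out: "\<bar>i\<bar> > int n \<Longrightarrow> \<pi> i = i" for i
    using \<pi> by (auto simp: signed_perms_def)
  have "bij_betw (\<lambda>i. \<bar>neg_word n \<pi> i\<bar>) {1..int n} {1..int n} \<longleftrightarrow>
        bij_betw (\<lambda>i. \<bar>\<pi> i\<bar>) {1..int n} {1..int n}"
    by (intro bij_betw_cong) (auto simp: neg_word_def)
  then have "neg_word n \<pi> \<in> signed_perms n"
    using \<pi> by (auto simp: signed_perms_def neg_word_def)
  moreover have "neg_word n \<pi> (neg_word n \<pi> i) = i" for i
    using signed_perms_abs_le[OF \<pi>, of i] odd inv out by (auto simp: neg_word_def)
  ultimately show ?thesis
    by (auto simp: involutions_B_def)
qed

lemma fix_B_neg_word [simp]: "fix_B n (neg_word n \<pi>) = fix_B n \<pi>"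
  unfolding fix_B_def by (intro arg_cong[where f = card]) (auto simp: neg_word_def)

lemma des_B_le: "des_B n \<pi> \<le> n"
proof -
  have "des_B n \<pi> \<le> card {0..int n - 1}"
    unfolding des_B_def by (intro card_mono) auto
  then show ?thesis by simp
qed

text \<open>Injectivity excludes ties, so each of the \<open>n\<close> positions, including position
  0, is a descent of exactly one of the two words.\<close>

lemma des_B_neg_word:
  assumes "inj \<pi>"
  shows "des_B n (neg_word n \<pi>) = n - des_B n \<pi>"
proof -
  let ?D = "{i. 0 \<le> i \<and> i \<le> int n - 1 \<and> \<pi> i > \<pi> (i + 1)}"
  have D: "\<pi> i < \<pi> (i + 1) \<longleftrightarrow> \<not> \<pi> (i + 1) < \<pi> i" for i
    using injD[OF assms, of i "i + 1"] by (cases "\<pi> i" "\<pi> (i + 1)" rule: linorder_cases) auto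
  have "neg_word n \<pi> i > neg_word n \<pi> (i + 1) \<longleftrightarrow> \<pi> i < \<pi> (i + 1)"
    if "0 \<le> i" "i \<le> int n - 1" for i
    using that by (simp add: neg_word_def)
  then have "{i. 0 \<le> i \<and> i \<le> int n - 1 \<and> neg_word n \<pi> i > neg_word n \<pi> (i + 1)}
      = {0..int n - 1} - ?D"
    unfolding D by auto
  moreover have "?D \<subseteq> {0..int n - 1}" by auto
  ultimately show ?thesis
    unfolding des_B_def by (simp add: card_Diff_subset finite_subset)
qed

section \<open>Existence and uniqueness of \<open>P\<^sub>j\<close>\<close>

lemma P_B_exists:
  "\<exists>P. degree P \<le> j \<and>
     (\<forall>t. t \<noteq> -1 \<longrightarrow> poly (J_B (2 * j)) t = (1 + t) ^ (2 * j) * poly P (t / (1 + t) ^ 2))"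
proof -
  define S where "S = {\<pi>. \<pi> \<in> involutions_B (2 * j) \<and> fix_B (2 * j) \<pi> = 0}"
  define d where "d = des_B (2 * j)"
  have d_le: "d \<pi> \<le> 2 * j" for \<pi>
    by (simp add: d_def des_B_le)
  have d_neg: "d (neg_word (2 * j) \<pi>) = 2 * j - d \<pi>" if "\<pi> \<in> S" for \<pi>
  proof -
    have "\<pi> \<circ> \<pi> = id" using that by (simp add: S_def involutions_B_def)
    then have "inj \<pi>" by (intro inj_on_inverseI[of _ \<pi>]) (simp add: fun_eq_iff)
    then show ?thesis by (simp add: d_def des_B_neg_word)
  qed
  \<comment> \<open>The bound on \<open>e\<close> sits under the existential quantifier so that
    \<open>choice\<close> yields a total function \<open>Q\<close>.\<close>
  have "\<forall>e. \<exists>Q :: real poly. e \<le> 2 * j \<longrightarrow> degree Q \<le> j \<and>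
      (\<forall>u v. u + v = 1 \<longrightarrow> u ^ (2 * j - e) * v ^ e + u ^ e * v ^ (2 * j - e) = poly Q (u * v))"
  proof
    fix e
    show "\<exists>Q :: real poly. e \<le> 2 * j \<longrightarrow> degree Q \<le> j \<and>
      (\<forall>u v. u + v = 1 \<longrightarrow> u ^ (2 * j - e) * v ^ e + u ^ e * v ^ (2 * j - e) = poly Q (u * v))"
      using symmetric_monomial_poly[of "2 * j - e" e, where 'a = real] by (cases "e \<le> 2 * j") auto
  qed
  from choice[OF this] obtain Q :: "nat \<Rightarrow> real poly" where Q: "\<And>e. e \<le> 2 * j \<Longrightarrow> degree (Q e) \<le> j"
    "\<And>e u v. e \<le> 2 * j \<Longrightarrow> u + v = 1 \<Longrightarrow>
       u ^ (2 * j - e) * v ^ e + u ^ e * v ^ (2 * j - e) = poly (Q e) (u * v)"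
    by blast
  \<comment> \<open>Each \<open>Q (d \<pi>)\<close> carries the monomial of \<open>\<pi>\<close> and
    its mirror image; the factor 1/2 corrects the double count.\<close>
  define P where "P = smult (1 / 2) (\<Sum>\<pi>\<in>S. Q (d \<pi>))"
  have "coeff P i = 0" if "i > j" for i
  proof -
    have "coeff (Q (d \<pi>)) i = 0" for \<pi>
      using Q(1)[OF d_le, of \<pi>] that by (intro coeff_eq_0) linarith
    then show ?thesis by (simp add: P_def coeff_sum)
  qed
  then have "degree P \<le> j"
    by (intro degree_le) auto
  moreover have "poly (J_B (2 * j)) t = (1 + t) ^ (2 * j) * poly P (t / (1 + t) ^ 2)"
    if "t \<noteq> -1" for t
  proof -
    define u v where "u = 1 / (1 + t)" and "v = t / (1 + t)"
    have t: "1 + t \<noteq> 0" using that by linarith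
    have uv: "u + v = 1" "u * v = t / (1 + t) ^ 2"
      using t by (simp_all add: u_def v_def power2_eq_square flip: add_divide_distrib)
    have "2 * poly P (u * v) = (\<Sum>\<pi>\<in>S. u ^ (2 * j - d \<pi>) * v ^ d \<pi> + u ^ d \<pi> * v ^ (2 * j - d \<pi>))"
      using Q(2)[OF d_le uv(1)] by (simp add: P_def poly_sum)
    also have "\<dots> = (\<Sum>\<pi>\<in>S. u ^ (2 * j - d \<pi>) * v ^ d \<pi>) + (\<Sum>\<pi>\<in>S. u ^ d \<pi> * v ^ (2 * j - d \<pi>))"
      by (rule sum.distrib)
    \<comment> \<open>Reindexing by the involution \<open>neg_word\<close>, which preserves
      \<open>S\<close>, swaps the exponents \<open>d \<pi>\<close> and
      \<open>2 * j - d \<pi>\<close>.\<close>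
    also have "(\<Sum>\<pi>\<in>S. u ^ d \<pi> * v ^ (2 * j - d \<pi>)) = (\<Sum>\<pi>\<in>S. u ^ (2 * j - d \<pi>) * v ^ d \<pi>)"
      by (rule sum.reindex_bij_witness[of _ "neg_word (2 * j)" "neg_word (2 * j)"])
        (auto simp: d_neg d_le, auto simp: S_def neg_word_involutions_B)
    finally have "poly P (u * v) = (\<Sum>\<pi>\<in>S. u ^ (2 * j - d \<pi>) * v ^ d \<pi>)"
      by simp
    moreover have "(1 + t) ^ (2 * j) * (u ^ (2 * j - e) * v ^ e) = t ^ e" if "e \<le> 2 * j" for e
    proof -
      have "(1 + t) ^ (2 * j) = (1 + t) ^ (2 * j - e) * (1 + t) ^ e"
        using that by (simp flip: power_add)
      then show ?thesis
        using t by (simp add: u_def v_def power_divide)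
    qed
    ultimately show ?thesis
      using d_le by (simp add: J_B_def uv(2)[symmetric] S_def[symmetric] d_def[symmetric] poly_sum poly_monom sum_distrib_left)
  qed
  ultimately show ?thesis by blast
qed

text \<open>The map \<open>t / (1 + t) ^ 2\<close> is injective on the open unit interval, so the
  two polynomials agree at infinitely many points.\<close>

lemma poly_eqI_on_image:
  fixes P Q :: "real poly"
  assumes "\<And>t. t \<noteq> -1 \<Longrightarrow> poly P (t / (1 + t) ^ 2) = poly Q (t / (1 + t) ^ 2)"
  shows "P = Q"
proof (rule ccontr)
  assume "P \<noteq> Q"
  then have "finite {x. poly (P - Q) x = 0}"
    by (intro poly_roots_finite) simp
  moreover have "(\<lambda>t. t / (1 + t) ^ 2) ` {0<..<1} \<subseteq> {x. poly (P - Q) x = 0}"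
    using assms by auto
  moreover have "inj_on (\<lambda>t :: real. t / (1 + t) ^ 2) {0<..<1}"
  proof (rule inj_onI)
    fix s t :: real
    assume st: "s \<in> {0<..<1}" "t \<in> {0<..<1}" and eq: "s / (1 + s) ^ 2 = t / (1 + t) ^ 2"
    have "s * (1 + t) ^ 2 = t * (1 + s) ^ 2"
      using eq st by (simp add: frac_eq_eq)
    then have "(s - t) * (1 - s * t) = 0"
      by (simp add: power2_eq_square algebra_simps)
    moreover have "s * t < 1"
      using st mult_strict_mono[of s 1 t 1] by simp
    ultimately show "s = t" by simp
  qed
  ultimately have "finite {0<..<1 :: real}"
    using finite_subset finite_imageD by metis
  then show False using infinite_Ioo[of 0 "1 :: real"] by simp
qed

text \<open>Existence and uniqueness together make the description in \<open>P_B\<close> meaningful.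
  Only the degree bound is extracted, since it suffices to clear the denominators below.\<close>

lemma degree_P_B: "degree (P_B j) \<le> j"
proof -
  let ?good = "\<lambda>P. degree P \<le> j \<and>
     (\<forall>t. t \<noteq> -1 \<longrightarrow> poly (J_B (2 * j)) t = (1 + t) ^ (2 * j) * poly P (t / (1 + t) ^ 2))"
  have "P = Q" if "?good P" "?good Q" for P Q
  proof (rule poly_eqI_on_image)
    fix t :: real
    assume t: "t \<noteq> -1"
    then have "(1 + t) ^ (2 * j) * poly P (t / (1 + t) ^ 2) = (1 + t) ^ (2 * j) * poly Q (t / (1 + t) ^ 2)"
      using that by metis
    moreover have "1 + t \<noteq> 0" using t by linarith
    ultimately show "poly P (t / (1 + t) ^ 2) = poly Q (t / (1 + t) ^ 2)" by simp
  qed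
  then have "\<exists>!P. ?good P" using P_B_exists[of j] by blast
  from theI'[OF this] show ?thesis unfolding P_B_def by blast
qed

section \<open>The coefficient of \<open>W\<close>\<close>

text \<open>In the term of index \<open>s \<le> j\<close> the denominator is the
  \<open>2 * s\<close>-th power of \<open>1 + 4 * gf_x * gf_W\<close>, which cancels against the
  prefactor and leaves the exponent \<open>2 * (j - s)\<close>.\<close>

lemma A_gf_altdef:
  "A_gf j = (\<Sum>s\<le>j. fps_const (fps_const (coeff (P_B j) s)) *
     ((1 + 4 * gf_x * gf_W) ^ (2 * (j - s)) * (gf_x * (1 + 2 * gf_W + 4 * gf_x * gf_W ^ 2)) ^ s))"
proof -
  define c where "c = (1 + 4 * gf_x * gf_W :: real fps fps)"
  define y where "y = gf_x * (1 + 2 * gf_W + 4 * gf_x * gf_W ^ 2)"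
  define z where "z = y / c ^ 2"
  have z: "z * c ^ 2 = y"
    unfolding z_def c_def by (rule gf_quotient)
  let ?Q = "map_poly (\<lambda>c. fps_const (fps_const c)) (P_B j)"
  have "degree ?Q \<le> j"
    using degree_P_B[of j] map_poly_degree_leq[of "\<lambda>c. fps_const (fps_const c)" "P_B j"] by linarith
  then have "poly ?Q z = (\<Sum>s\<le>j. coeff ?Q s * z ^ s)"
    by (simp add: poly_altdef sum.mono_neutral_left coeff_eq_0)
  also have "c ^ (2 * j) * \<dots> = (\<Sum>s\<le>j. fps_const (fps_const (coeff (P_B j) s)) * (c ^ (2 * (j - s)) * y ^ s))"
    unfolding sum_distrib_left
  proof (rule sum.cong)
    fix s assume "s \<in> {..j}"
    then have "c ^ (2 * j) = c ^ (2 * (j - s)) * (c ^ 2) ^ s"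
      by (simp flip: power_add power_mult add: algebra_simps)
    then have "c ^ (2 * j) * z ^ s = c ^ (2 * (j - s)) * y ^ s"
      by (simp add: z[symmetric] power_mult_distrib mult_ac)
    then show "c ^ (2 * j) * (coeff ?Q s * z ^ s) =
        fps_const (fps_const (coeff (P_B j) s)) * (c ^ (2 * (j - s)) * y ^ s)"
      by (simp add: coeff_map_poly mult_ac)
  qed simp
  finally show ?thesis
    by (simp add: A_gf_def c_def y_def z_def)
qed

lemma fps_power_nth_1:
  fixes f :: "'a :: comm_ring_1 fps"
  assumes "f $ 0 = 1"
  shows "(f ^ n) $ 1 = of_nat n * f $ 1"
  using assms by (induction n) (auto simp: fps_mult_nth fps_power_zeroth algebra_simps)

theorem corollary6p1:
  fixes j k :: nat
  shows "A_coeff j k 1 =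
    2 * real k * D_B j (int k) + 8 * (real j - real k + 1) * D_B j (int k - 1)"
proof -
  define c where "c = (1 + 4 * gf_x * gf_W :: real fps fps)"
  define e where "e = (1 + 2 * gf_W + 4 * gf_x * gf_W ^ 2 :: real fps fps)"
  define D where "D = coeff (P_B j)"
  have num: "numeral w = (fps_const (numeral w) :: real fps fps)" for w
    by (simp add: numeral_fps_const)
  have c: "c $ 0 = 1" "c $ 1 = 4 * fps_X"
    by (simp_all add: c_def gf_x_def gf_W_def num mult.assoc)
  have e: "e $ 0 = 1" "e $ 1 = 2"
    by (simp_all add: e_def gf_x_def gf_W_def num mult.assoc fps_X_power_nth)
  \<comment> \<open>Both \<open>c\<close> and \<open>e\<close> have constant term 1, so the linear
    coefficients of their powers add up: \<open>2 * (j - s)\<close> times \<open>4 x\<close> plus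
    \<open>s\<close> times 2, all multiplied by \<open>x ^ s\<close>.\<close>
  have coeff_W: "(c ^ (2 * (j - s)) * (gf_x * e) ^ s) $ 1 =
      fps_const (8 * real (j - s)) * fps_X ^ Suc s + fps_const (2 * real s) * fps_X ^ s" for s
  proof -
    have "(c ^ (2 * (j - s)) * e ^ s) $ 1 = of_nat (2 * (j - s)) * (4 * fps_X) + of_nat s * 2"
      using fps_power_nth_1[OF c(1), of "2 * (j - s)"] fps_power_nth_1[OF e(1), of s] c e
      by (simp add: fps_mult_nth fps_power_zeroth)
    also have "\<dots> = fps_const (8 * real (j - s)) * fps_X + fps_const (2 * real s)"
      by (simp flip: fps_const_mult fps_of_nat add: numeral_fps_const)
    finally have "(fps_const (fps_X ^ s) * (c ^ (2 * (j - s)) * e ^ s)) $ 1 =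
        fps_X ^ s * (fps_const (8 * real (j - s)) * fps_X + fps_const (2 * real s))"
      by simp
    also have "fps_const (fps_X ^ s) * (c ^ (2 * (j - s)) * e ^ s) = c ^ (2 * (j - s)) * (gf_x * e) ^ s"
      by (simp add: power_mult_distrib gf_x_def mult_ac)
    finally show ?thesis by (simp only: power_Suc distrib_left mult_ac)
  qed
  have "A_coeff j k 1 = (\<Sum>s\<le>j. D s * ((if k = Suc s then 8 * real (j - s) else 0) + (if k = s then 2 * real s else 0)))"
    unfolding A_coeff_def A_gf_altdef c_def[symmetric] e_def[symmetric] D_def[symmetric]
    unfolding fps_sum_nth fps_mult_left_const_nth coeff_W
    by (intro sum.cong refl) (simp add: fps_X_power_nth del: power_Suc)
  also have "\<dots> = (\<Sum>s\<le>j. if k = Suc s then 8 * real (j - s) * D s else 0) + (\<Sum>s\<le>j. if k = s then 2 * real s * D s else 0)"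
    unfolding sum.distrib[symmetric] by (intro sum.cong) auto
  also have "(\<Sum>s\<le>j. if k = s then 2 * real s * D s else 0) = 2 * real k * D_B j (int k)"
    by (simp add: D_B_def D_def)
  \<comment> \<open>Only \<open>s = k - 1\<close> contributes, with
    \<open>j - s = j - k + 1\<close>. For \<open>k = 0\<close> or \<open>k > j + 1\<close> there is
    no such index, and \<open>D_B\<close> is zero by convention.\<close>
  also have "(\<Sum>s\<le>j. if k = Suc s then 8 * real (j - s) * D s else 0) =
      8 * (real j - real k + 1) * D_B j (int k - 1)"
    by (cases k) (auto simp: D_B_def D_def of_nat_diff)
  finally show ?thesis by simp
qed

end
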